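(* Let $A$ be an associative algebra over $\mathbb{C}$, let $\lambda\in\mathbb{C}$, and let $\xi\in A$ be a quasi-idempotent element of weight $\lambda$. Define $P_\xi:A\to A$ by $P_\xi(a)=\xi a$ for all $a\in A$. Then $P_\xi$ is a quasi-idempotent Rota-Baxter operator of weight $\lambda$ on $A$; that is, $P_\xi$ is both a quasi-idempotent operator of weight $\lambda$ and a Rota-Baxter operator of weight $\lambda$ on $A$.
   Context: The ground field is $\mathbb{C}$. Let $A$ be an associative algebra and $\lambda\in\mathbb{C}$. A nonzero element $\xi\in A$ is called a quasi-idempotent element of weight $\lambda$ if $\xi^2=-\lambda\xi$. A linear endomorphism $\phi$ of $A$ is called a quasi-idempotent operator of weight $\lambda$ if $\phi^2=\phi\circ\phi=-\lambda\phi$. A linear endomorphism $P$ of $A$ is called a Rota-Baxter operator of weight $\lambda$ if $P(a)P(b)=P(aP(b))+P(P(a)b)+\lambda P(ab)$ for all $a,b\in A$. *)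

theory Defs
  imports Complex_Main
begin

text \<open>
  The class \<^class>\<open>ring\<close> has no unit and no commutativity assumption, so \<open>complex_algebra\<close>
  describes associative, not necessarily unital algebras.
\<close>

locale complex_algebra = vector_space scale
  for scale :: "complex \<Rightarrow> 'a::ring \<Rightarrow> 'a" +
  assumes mult_scale_left: "scale c x * y = scale c (x * y)"
    and mult_scale_right: "x * scale c y = scale c (x * y)"

definition quasi_idempotent_element ::
    "(complex \<Rightarrow> 'a::ring \<Rightarrow> 'a) \<Rightarrow> complex \<Rightarrow> 'a \<Rightarrow> bool" where
  "quasi_idempotent_element scale lam \<xi> \<longleftrightarrow> \<xi> \<noteq> 0 \<and> \<xi> * \<xi> = scale (- lam) \<xi>"

definition quasi_idempotent_operator ::
    "(complex \<Rightarrow> 'a::ring \<Rightarrow> 'a) \<Rightarrow> complex \<Rightarrow> ('a \<Rightarrow> 'a) \<Rightarrow> bool" where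
  "quasi_idempotent_operator scale lam \<phi> \<longleftrightarrow>
     Vector_Spaces.linear scale scale \<phi> \<and> \<phi> \<circ> \<phi> = (\<lambda>a. scale (- lam) (\<phi> a))"

definition rota_baxter_operator ::
    "(complex \<Rightarrow> 'a::ring \<Rightarrow> 'a) \<Rightarrow> complex \<Rightarrow> ('a \<Rightarrow> 'a) \<Rightarrow> bool" where
  "rota_baxter_operator scale lam P \<longleftrightarrow>
     Vector_Spaces.linear scale scale P \<and>
     (\<forall>a b. P a * P b = P (a * P b) + P (P a * b) + scale lam (P (a * b)))"

end

theory Submission
  imports Defs
begin

text \<open>By associativity, applying left multiplication by \<xi> twice is left multiplication by
  \<xi>\<xi> = -\<lambda>\<xi>, which gives \<open>sq\<close>. In the Rota-Baxter identity, P(a)P(b)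
  and P(aP(b)) are both \<xi>a\<xi>b, so what remains is P(P(a)b) + \<lambda>P(ab) = 0, and this is
  \<open>sq\<close> at ab.\<close>

lemma (in complex_algebra) linear_mult_left:
  "Vector_Spaces.linear scale scale (\<lambda>a. \<xi> * a)"
  by unfold_locales (simp_all add: distrib_left mult_scale_right)

theorem proposition2p2:
  fixes scale :: "complex \<Rightarrow> 'a::ring \<Rightarrow> 'a" and lam :: complex and \<xi> :: 'a
  assumes "complex_algebra scale"
    and "quasi_idempotent_element scale lam \<xi>"
  shows "quasi_idempotent_operator scale lam (\<lambda>a. \<xi> * a) \<and>
         rota_baxter_operator scale lam (\<lambda>a. \<xi> * a)"
proof -
  interpret complex_algebra scale by fact
  have sq: "\<xi> * (\<xi> * a) = scale (- lam) (\<xi> * a)" for a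
    using assms(2) by (simp add: quasi_idempotent_element_def mult_scale_left flip: mult.assoc)
  have "\<xi> * a * (\<xi> * b) = \<xi> * (a * (\<xi> * b)) + \<xi> * (\<xi> * a * b) + scale lam (\<xi> * (a * b))" for a b
    \<comment> \<open>With all products bracketed to the right, the first summand equals the
      left-hand side, and this instance of \<open>sq\<close> makes the other two cancel.\<close>
    using sq[of "a * b"] by (simp add: mult.assoc scale_minus_left)
  with sq linear_mult_left show ?thesis
    by (auto simp: quasi_idempotent_operator_def rota_baxter_operator_def fun_eq_iff)
qed

end
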